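(* Let $B_1,\dots,B_n\in\mathbb{C}^{p\times m}$, let $F_o(z)=z^{-1}B_1+\cdots+z^{-n}B_n$, and let $$\mathbf{H}_0=\begin{pmatrix}B_1&B_2&\cdots&B_n\\ B_2&\cdots&B_n&0\\ \vdots&&&\vdots\\ B_n&0&\cdots&0\end{pmatrix}$$ be the corresponding $np\times nm$ Hankel matrix, i.e. its $(i,j)$ block is $B_{i+j-1}$ if $i+j-1\le n$ and $0_{p\times m}$ otherwise. Then $F_o(z)$ is in $\mathcal{U}$ if and only if $$\left(I_{nm}-\mathbf{H}_0^*\mathbf{H}_0\right)\begin{pmatrix}I_m\\ 0_{m(n-1)\times m}\end{pmatrix}=0_{nm\times m}\qquad\text{in the case }p\ge m,$$ $$\begin{pmatrix}I_p&0_{p\times(n-1)p}\end{pmatrix}\left(I_{np}-\mathbf{H}_0\mathbf{H}_0^*\right)=0_{p\times np}\qquad\text{in the case }m\ge p.$$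
   Context: With $\mathbb{T}=\{z\in\mathbb{C}:|z|=1\}$, the class $\mathcal{U}$ consists of the $p\times m$-valued rational functions with $F(z)^*F(z)=I_m$ for all $z\in\mathbb{T}$ if $p\ge m$ (isometry), and $F(z)F(z)^*=I_p$ for all $z\in\mathbb{T}$ if $m\ge p$ (co-isometry). *)

theory Defs
  imports
    Complex_Main
    "HOL-Computational_Algebra.Polynomial"
    "Jordan_Normal_Form.Schur_Decomposition"
begin

text \<open>
  A scalar rational function is represented by a total function that agrees with a quotient in
  lowest terms away from the zeros of the denominator. Because of coprimality these zeros are
  exactly the poles, so the function is only unconstrained at genuine poles (where HOL functions
  must still take some value).
\<close>

definition rational_fun :: "(complex \<Rightarrow> complex) \<Rightarrow> bool" where
  "rational_fun f \<longleftrightarrow>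
     (\<exists>P Q. Q \<noteq> 0 \<and> coprime P Q \<and> (\<forall>z. poly Q z \<noteq> 0 \<longrightarrow> f z = poly P z / poly Q z))"

definition rational_mat_fun :: "nat \<Rightarrow> nat \<Rightarrow> (complex \<Rightarrow> complex mat) \<Rightarrow> bool" where
  "rational_mat_fun p m F \<longleftrightarrow>
     (\<forall>z. F z \<in> carrier_mat p m) \<and> (\<forall>i<p. \<forall>j<m. rational_fun (\<lambda>z. F z $$ (i, j)))"

text \<open>
  Values at poles cannot interfere with the conditions on the unit circle: the identities bound
  the entries on the whole circle, so they force the absence of poles there.
\<close>

definition class_U :: "nat \<Rightarrow> nat \<Rightarrow> (complex \<Rightarrow> complex mat) set" where
  "class_U p m = {F. rational_mat_fun p m F \<and>
     (p \<ge> m \<longrightarrow> (\<forall>z. cmod z = 1 \<longrightarrow> mat_adjoint (F z) * F z = 1\<^sub>m m)) \<and>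
     (m \<ge> p \<longrightarrow> (\<forall>z. cmod z = 1 \<longrightarrow> F z * mat_adjoint (F z) = 1\<^sub>m p))}"

definition F_o :: "nat \<Rightarrow> nat \<Rightarrow> nat \<Rightarrow> (nat \<Rightarrow> complex mat) \<Rightarrow> complex \<Rightarrow> complex mat" where
  "F_o p m n B z = mat p m (\<lambda>(i, j). \<Sum>k = 1..n. z powi (- int k) * B k $$ (i, j))"

text \<open>
  Matrix indices start at 0, so the entry \<open>(i, j)\<close> lies in the block with 1-based block indices
  \<open>(i div p + 1, j div m + 1)\<close>, which is \<open>B\<close> at index \<open>i div p + j div m + 1\<close>.
\<close>

definition hankel_H0 :: "nat \<Rightarrow> nat \<Rightarrow> nat \<Rightarrow> (nat \<Rightarrow> complex mat) \<Rightarrow> complex mat" where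
  "hankel_H0 p m n B = mat (n * p) (n * m) (\<lambda>(i, j).
     let k = i div p + j div m + 1
     in if k \<le> n then B k $$ (i mod p, j mod m) else 0)"

definition append_cols :: "'a :: zero mat \<Rightarrow> 'a mat \<Rightarrow> 'a mat" where
  "append_cols A B = four_block_mat A B (0\<^sub>m 0 (dim_col A)) (0\<^sub>m 0 (dim_col B))"

end

theory Submission
  imports Defs
begin

text \<open>
  On the unit circle \<open>cnj z = inverse z\<close>, so each entry of \<open>F_o(z)\<^sup>* F_o(z) - I\<close> is a Laurent
  polynomial in \<open>z\<close>. It vanishes on the whole circle, an infinite set, if and only if all its
  coefficients vanish (\<open>poly_zero_on_circle_iff\<close>). The coefficient of \<open>z\<^sup>d\<close> is the block
  autocorrelation \<open>\<Sum>\<^sub>l B\<^bsub>l+d\<^esub>\<^sup>* B\<^sub>l\<close>, minus \<open>I\<close> when \<open>d = 0\<close>. The coefficient of \<open>z\<^bsup>-d\<^esup>\<close> is the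
  adjoint of that of \<open>z\<^sup>d\<close>, so only \<open>d \<ge> 0\<close> matters (\<open>isometric_on_circle_iff\<close>). These
  autocorrelations are precisely the blocks in the first block column of \<open>H\<^sub>0\<^sup>* H\<^sub>0\<close>
  (\<open>hankel_first_block_column_iff\<close>).

  The co-isometric case follows the same way, with the transposed coefficients in place of
  \<open>B\<^sub>k\<close>: entry \<open>(j, i)\<close> of \<open>F_o(z) F_o(z)\<^sup>*\<close> is a sum over columns in which the factor from row \<open>i\<close>
  is conjugated, and the first block row of \<open>H\<^sub>0 H\<^sub>0\<^sup>*\<close> consists of the matching autocorrelations
  (\<open>hankel_first_block_row_iff\<close>). To serve both cases, the core lemmas speak of an array of
  scalars. For \<open>p = m\<close> the class asks for both identities, but a one-sided inverse of a square
  matrix is two-sided. That \<open>F_o\<close> is rational holds unconditionally.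
\<close>

section \<open>Laurent polynomials on the unit circle\<close>

lemma infinite_unit_circle: "infinite {z::complex. cmod z = 1}"
proof
  assume fin: "finite {z::complex. cmod z = 1}"
  define N where "N = card {z::complex. cmod z = 1}"
  \<comment> \<open>There are more roots of unity of order \<open>N + 1\<close> than points on the circle.\<close>
  have "{z::complex. z ^ Suc N = 1} \<subseteq> {z. cmod z = 1}"
  proof
    fix z :: complex assume "z \<in> {z. z ^ Suc N = 1}"
    then have "z ^ Suc N = 1" by blast
    then have "cmod z ^ Suc N = 1" unfolding norm_power[symmetric] by (simp only: norm_one)
    then show "z \<in> {z. cmod z = 1}"
      using power_eq_imp_eq_base[of "cmod z" "Suc N" 1] by simp
  qed
  then have "card {z::complex. z ^ Suc N = 1} \<le> N"
    unfolding N_def using fin by (intro card_mono) auto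
  then show False using card_roots_unity_eq[of "Suc N"] by simp
qed

lemma poly_zero_on_circle_iff:
  fixes q :: "complex poly"
  shows "(\<forall>z. cmod z = 1 \<longrightarrow> poly q z = 0) \<longleftrightarrow> q = 0"
proof
  assume "\<forall>z. cmod z = 1 \<longrightarrow> poly q z = 0"
  then have "{z. cmod z = 1} \<subseteq> {z. poly q z = 0}" by auto
  then show "q = 0" using infinite_unit_circle poly_roots_finite finite_subset by blast
qed simp

lemma coprime_power_of_variable:
  fixes P :: "complex poly"
  assumes "poly P 0 \<noteq> 0"
  shows "coprime P (monom 1 n)"
proof -
  obtain a P' where P: "P = pCons a P'" by (cases P)
  have a: "a \<noteq> 0" using assms P by simp
  show ?thesis
  proof (rule coprimeI)
    fix d assume dP: "d dvd P" and "d dvd monom 1 n"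
    then show "d dvd 1"
    proof (induction n)
      case 0
      then show ?case by simp
    next
      case (Suc n)
      \<comment> \<open>Multiplying \<open>P = a + z P'\<close> by \<open>z\<^sup>n\<close> lowers the exponent by one.\<close>
      have "P * monom 1 n = smult a (monom 1 n) + P' * monom 1 (Suc n)"
        by (simp add: P monom_Suc)
      then have "smult a (monom 1 n) = P * monom 1 n - P' * monom 1 (Suc n)" by simp
      then have "d dvd smult a (monom 1 n)"
        using Suc.prems by (metis dvd_diff dvd_mult dvd_mult2)
      then show ?case using Suc a by (simp add: dvd_smult_iff)
    qed
  qed
qed

text \<open>
  At \<open>z = 0\<close> the sum takes the value 0. This is compatible with the lowest-terms representation:
  the denominator vanishes at 0 unless all coefficients are zero.
\<close>

lemma rational_fun_negative_powers:
  "rational_fun (\<lambda>z. \<Sum>k = 1..n. z powi (- int k) * b k)"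
proof (induction n)
  case 0
  have "\<exists>P Q :: complex poly. Q \<noteq> 0 \<and> coprime P Q \<and> (\<forall>z. poly Q z \<noteq> 0 \<longrightarrow> 0 = poly P z / poly Q z)"
    by (rule exI[of _ 0], rule exI[of _ 1]) simp
  then show ?case by (simp add: rational_fun_def)
next
  case (Suc n)
  show ?case
  proof (cases "b (Suc n) = 0")
    case True
    then show ?thesis using Suc by simp
  next
    case False
    define P where "P = (\<Sum>k = 1..Suc n. monom (b k) (Suc n - k))"
    have "poly P 0 = (\<Sum>k = 1..Suc n. if k = Suc n then b k else 0)"
      unfolding P_def poly_sum by (intro sum.cong) (auto simp: poly_monom power_0_left)
    also have "\<dots> = b (Suc n)" by simp
    finally have "coprime P (monom 1 (Suc n))"
      using False by (intro coprime_power_of_variable) simp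
    moreover have "(\<Sum>k = 1..Suc n. z powi (- int k) * b k) = poly P z / poly (monom 1 (Suc n)) z"
      if "poly (monom 1 (Suc n)) z \<noteq> 0" for z
    proof -
      have z: "z \<noteq> 0" using that by (auto simp: poly_monom)
      have "z powi (- int k) * b k = poly (monom (b k) (Suc n - k)) z / z ^ Suc n"
        if "k \<in> {1..Suc n}" for k
      proof -
        have "z ^ Suc n = z ^ (Suc n - k) * z ^ k"
          using that by (simp add: power_add[symmetric])
        then show ?thesis using z
          by (simp add: poly_monom power_int_minus field_simps del: power_Suc)
      qed
      then show ?thesis
        by (simp add: P_def poly_sum sum_divide_distrib poly_monom del: power_Suc sum.cl_ivl_Suc)
    qed
    moreover have "monom 1 (Suc n) \<noteq> (0 :: complex poly)" by simp
    ultimately show ?thesis unfolding rational_fun_def by blast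
  qed
qed

section \<open>Autocorrelations and isometry on the circle\<close>

text \<open>
  The array \<open>X k r i\<close> stands for the entry \<open>(r, i)\<close> of the coefficient of \<open>z\<^bsup>-(k+1)\<^esup>\<close>; the
  coefficients are numbered from 0 and there are \<open>n\<close> of them, each with \<open>N\<close> rows. The value is the
  entry \<open>(i, j)\<close> of \<open>\<Sum>\<^sub>l X\<^bsub>l+d\<^esub>\<^sup>* X\<^sub>l\<close>, where \<open>l\<close> runs over \<open>l + d < n\<close>.
\<close>

definition autocorr ::
    "nat \<Rightarrow> nat \<Rightarrow> (nat \<Rightarrow> nat \<Rightarrow> nat \<Rightarrow> complex) \<Rightarrow> nat \<Rightarrow> nat \<Rightarrow> nat \<Rightarrow> complex" where
  "autocorr n N X d i j =
     (\<Sum>l<n. if l + d < n then \<Sum>r<N. cnj (X (l + d) r i) * X l r j else 0)"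

lemma autocorr_eq_double_sum:
  "autocorr n N X d i j =
     (\<Sum>l<n. \<Sum>r<N. if l + d < n then cnj (X (l + d) r i) * X l r j else 0)"
  unfolding autocorr_def by (intro sum.cong refl) simp

text \<open>The entry \<open>(r, i)\<close> of the Laurent sum \<open>\<Sum>\<^sub>k z\<^bsup>-(k+1)\<^esup> X\<^sub>k\<close>.\<close>

definition laurent_val ::
    "nat \<Rightarrow> (nat \<Rightarrow> nat \<Rightarrow> nat \<Rightarrow> complex) \<Rightarrow> complex \<Rightarrow> nat \<Rightarrow> nat \<Rightarrow> complex" where
  "laurent_val n X z r i = (\<Sum>k<n. z powi (- int (Suc k)) * X k r i)"

text \<open>
  With \<open>G\<close> the Laurent sum, the polynomial that agrees on the unit circle with the entry \<open>(i, j)\<close>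
  of \<open>z\<^sup>n (G(z)\<^sup>* G(z) - I)\<close>. The factor \<open>z\<^sup>n\<close> clears the negative powers, so the coefficient of
  \<open>z\<^sup>d\<close> in the Laurent polynomial moves to position \<open>n + d\<close>.
\<close>

definition defect_poly ::
    "nat \<Rightarrow> nat \<Rightarrow> (nat \<Rightarrow> nat \<Rightarrow> nat \<Rightarrow> complex) \<Rightarrow> nat \<Rightarrow> nat \<Rightarrow> complex poly" where
  "defect_poly n N X i j =
     (\<Sum>k<n. \<Sum>l<n. monom (\<Sum>r<N. cnj (X k r i) * X l r j) (n + k - l)) - monom (of_bool (i = j)) n"

lemma poly_defect_poly:
  assumes z: "cmod z = 1"
  shows "poly (defect_poly n N X i j) z =
    z ^ n * ((\<Sum>r<N. cnj (laurent_val n X z r i) * laurent_val n X z r j) - of_bool (i = j))"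
proof -
  have z0: "z \<noteq> 0" using z by auto
  have "z * cnj z = 1" using z complex_norm_square[of z] by simp
  then have cz: "cnj z = inverse z" using inverse_unique by metis
  have term_eq: "z ^ n * (cnj (z powi (- int (Suc k)) * a) * (z powi (- int (Suc l)) * b))
      = cnj a * b * z ^ (n + k - l)" if "l < n" for k l a b
  proof -
    have c: "cnj (z powi (- int (Suc k))) = z ^ Suc k"
      by (simp add: power_int_minus cz del: power_Suc of_nat_Suc flip: power_inverse)
    have i: "z powi (- int (Suc l)) = inverse (z ^ Suc l)"
      by (simp add: power_int_minus del: power_Suc of_nat_Suc)
    have e: "z ^ n * z ^ Suc k = z ^ (n + k - l) * z ^ Suc l"
      using that by (simp only: power_add[symmetric]) (rule arg_cong[of _ _ "power z"], simp)
    have "z ^ n * (cnj (z powi (- int (Suc k)) * a) * (z powi (- int (Suc l)) * b))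
        = cnj a * b * (z ^ n * z ^ Suc k) * inverse (z ^ Suc l)"
      by (simp only: complex_cnj_mult c i mult_ac)
    also have "\<dots> = cnj a * b * z ^ (n + k - l)"
      unfolding e using z0 by (simp add: field_simps)
    finally show ?thesis .
  qed
  have "z ^ n * (\<Sum>r<N. cnj (laurent_val n X z r i) * laurent_val n X z r j)
      = (\<Sum>r<N. \<Sum>k<n. \<Sum>l<n. z ^ n * (cnj (z powi (- int (Suc k)) * X k r i) *
           (z powi (- int (Suc l)) * X l r j)))"
    by (simp only: laurent_val_def cnj_sum sum_product) (simp only: sum_distrib_left)
  also have "\<dots> = (\<Sum>r<N. \<Sum>k<n. \<Sum>l<n. cnj (X k r i) * X l r j * z ^ (n + k - l))"
    by (intro sum.cong refl term_eq) simp
  also have "\<dots> = (\<Sum>k<n. \<Sum>r<N. \<Sum>l<n. cnj (X k r i) * X l r j * z ^ (n + k - l))"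
    by (rule sum.swap)
  also have "\<dots> = (\<Sum>k<n. \<Sum>l<n. \<Sum>r<N. cnj (X k r i) * X l r j * z ^ (n + k - l))"
    by (intro sum.cong refl sum.swap)
  also have "\<dots> = poly (\<Sum>k<n. \<Sum>l<n. monom (\<Sum>r<N. cnj (X k r i) * X l r j) (n + k - l)) z"
    by (simp add: poly_sum poly_monom sum_distrib_right)
  finally show ?thesis
    by (simp only: defect_poly_def poly_diff poly_monom right_diff_distrib mult.commute)
qed

lemma coeff_defect_poly_upper:
  "coeff (defect_poly n N X i j) (n + d) = autocorr n N X d i j - of_bool (d = 0 \<and> i = j)"
proof -
  have "(\<Sum>k<n. \<Sum>l<n. coeff (monom (\<Sum>r<N. cnj (X k r i) * X l r j) (n + k - l)) (n + d))
      = (\<Sum>l<n. \<Sum>k<n. coeff (monom (\<Sum>r<N. cnj (X k r i) * X l r j) (n + k - l)) (n + d))"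
    by (rule sum.swap)
  also have "\<dots> = (\<Sum>l<n. \<Sum>k<n. if k = l + d then \<Sum>r<N. cnj (X k r i) * X l r j else 0)"
    by (intro sum.cong refl) auto
  also have "\<dots> = autocorr n N X d i j"
    unfolding autocorr_def by (intro sum.cong refl) (simp add: sum.delta)
  finally show ?thesis by (auto simp: defect_poly_def coeff_sum)
qed

text \<open>The Laurent polynomial is Hermitian on the circle, hence the conjugate and the swapped indices.\<close>

lemma coeff_defect_poly_lower:
  assumes "d \<le> n"
  shows "coeff (defect_poly n N X i j) (n - d) =
    cnj (autocorr n N X d j i) - of_bool (d = 0 \<and> i = j)"
proof -
  have "(\<Sum>k<n. \<Sum>l<n. coeff (monom (\<Sum>r<N. cnj (X k r i) * X l r j) (n + k - l)) (n - d))
      = (\<Sum>k<n. \<Sum>l<n. if l = k + d then \<Sum>r<N. cnj (X k r i) * X l r j else 0)"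
    using assms by (intro sum.cong refl) auto
  also have "\<dots> = cnj (autocorr n N X d j i)"
    unfolding autocorr_def cnj_sum by (intro sum.cong refl) (simp add: sum.delta mult.commute)
  finally show ?thesis using assms by (auto simp: defect_poly_def coeff_sum)
qed

lemma autocorr_beyond: "n \<le> d \<Longrightarrow> autocorr n N X d i j = 0"
  by (simp add: autocorr_def)

lemma isometric_on_circle_iff:
  assumes n: "n \<ge> 1"
  shows "(\<forall>z. cmod z = 1 \<longrightarrow> (\<forall>i<M. \<forall>j<M.
            (\<Sum>r<N. cnj (laurent_val n X z r i) * laurent_val n X z r j) = of_bool (i = j)))
     \<longleftrightarrow> (\<forall>d<n. \<forall>i<M. \<forall>j<M. autocorr n N X d i j = of_bool (d = 0 \<and> i = j))"
    (is "?circle \<longleftrightarrow> ?corr")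
proof -
  have "poly (defect_poly n N X i j) z = 0 \<longleftrightarrow>
      (\<Sum>r<N. cnj (laurent_val n X z r i) * laurent_val n X z r j) = of_bool (i = j)"
    if "cmod z = 1" for z i j
  proof -
    have "z \<noteq> 0" using that by auto
    then show ?thesis by (simp add: poly_defect_poly[OF that] del: of_bool_eq_iff)
  qed
  then have "?circle \<longleftrightarrow>
      (\<forall>i<M. \<forall>j<M. \<forall>z. cmod z = 1 \<longrightarrow> poly (defect_poly n N X i j) z = 0)"
    by blast
  also have "\<dots> \<longleftrightarrow> (\<forall>i<M. \<forall>j<M. defect_poly n N X i j = 0)"
    by (simp only: poly_zero_on_circle_iff)
  also have "\<dots> \<longleftrightarrow> ?corr"
  proof
    assume *: "\<forall>i<M. \<forall>j<M. defect_poly n N X i j = 0"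
    show ?corr
    proof (intro allI impI)
      fix d i j assume "d < n" "i < M" "j < M"
      then show "autocorr n N X d i j = of_bool (d = 0 \<and> i = j)"
        using * coeff_defect_poly_upper[of n N X i j d] by simp
    qed
  next
    assume *: ?corr
    have all: "autocorr n N X d i j = of_bool (d = 0 \<and> i = j)" if "i < M" "j < M" for d i j
      using * that n by (cases "d < n") (auto simp: autocorr_beyond)
    show "\<forall>i<M. \<forall>j<M. defect_poly n N X i j = 0"
    proof (intro allI impI poly_eqI)
      fix i j e assume ij: "i < M" "j < M"
      show "coeff (defect_poly n N X i j) e = coeff 0 e"
      proof (cases "n \<le> e")
        case True
        then show ?thesis
          using coeff_defect_poly_upper[of n N X i j "e - n"] all[OF ij] by simp
      next
        case False
        then show ?thesis
          using coeff_defect_poly_lower[of "n - e" n N X i j] all[OF ij(2,1)] by auto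
      qed
    qed
  qed
  finally show ?thesis .
qed

section \<open>Entries of adjoints, block sums and Hankel products\<close>

lemma mat_adjoint_carrier: "A \<in> carrier_mat r c \<Longrightarrow> mat_adjoint A \<in> carrier_mat c r"
  unfolding mat_adjoint_def by auto

lemma index_mat_adjoint:
  fixes A :: "complex mat"
  assumes "A \<in> carrier_mat r c" "i < c" "j < r"
  shows "mat_adjoint A $$ (i, j) = cnj (A $$ (j, i))"
  using assms unfolding mat_adjoint_def by (auto simp: mat_of_rows_index)

lemma index_adjoint_mult:
  fixes A :: "complex mat"
  assumes "A \<in> carrier_mat r c" "i < c" "j < c"
  shows "(mat_adjoint A * A) $$ (i, j) = (\<Sum>k<r. cnj (A $$ (k, i)) * A $$ (k, j))"
proof -
  have "(mat_adjoint A * A) $$ (i, j) = row (mat_adjoint A) i \<bullet> col A j"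
    using assms mat_adjoint_carrier[OF assms(1)] by (subst index_mult_mat) auto
  also have "\<dots> = (\<Sum>k<r. mat_adjoint A $$ (i, k) * A $$ (k, j))"
    using assms mat_adjoint_carrier[OF assms(1)]
    by (auto simp: scalar_prod_def atLeast0LessThan intro!: sum.cong)
  finally show ?thesis using assms by (simp add: index_mat_adjoint)
qed

lemma index_mult_adjoint:
  fixes A :: "complex mat"
  assumes "A \<in> carrier_mat r c" "i < r" "j < r"
  shows "(A * mat_adjoint A) $$ (i, j) = (\<Sum>k<c. cnj (A $$ (j, k)) * A $$ (i, k))"
proof -
  have "(A * mat_adjoint A) $$ (i, j) = row A i \<bullet> col (mat_adjoint A) j"
    using assms mat_adjoint_carrier[OF assms(1)] by (subst index_mult_mat) auto
  also have "\<dots> = (\<Sum>k<c. A $$ (i, k) * mat_adjoint A $$ (k, j))"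
    using assms mat_adjoint_carrier[OF assms(1)]
    by (auto simp: scalar_prod_def atLeast0LessThan intro!: sum.cong)
  finally show ?thesis using assms by (simp add: index_mat_adjoint mult.commute)
qed

lemma sum_div_mod:
  fixes f :: "nat \<Rightarrow> nat \<Rightarrow> 'a::comm_monoid_add"
  shows "(\<Sum>x<n * p. f (x div p) (x mod p)) = (\<Sum>k<n. \<Sum>r<p. f k r)"
proof -
  have "(\<Sum>x<n * p. f (x div p) (x mod p))
      = (\<Sum>k<n. \<Sum>x = k * p..<k * p + p. f (x div p) (x mod p))"
    by (rule sum.nat_group[symmetric])
  also have "\<dots> = (\<Sum>k<n. \<Sum>r<p. f k r)"
  proof (rule sum.cong[OF refl])
    fix k
    have "(\<Sum>x = k * p..<k * p + p. f (x div p) (x mod p))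
        = (\<Sum>r = 0..<p. f ((r + k * p) div p) ((r + k * p) mod p))"
      using sum.shift_bounds_nat_ivl[of "\<lambda>x. f (x div p) (x mod p)" 0 "k * p" p]
      by (simp add: add.commute)
    then show "(\<Sum>x = k * p..<k * p + p. f (x div p) (x mod p)) = (\<Sum>r<p. f k r)"
      by (simp add: atLeast0LessThan)
  qed
  finally show ?thesis .
qed

lemma all_div_mod:
  "(\<forall>x<n * p. P (x div p) (x mod p)) \<longleftrightarrow> (\<forall>d<n. \<forall>i<(p::nat). P d i)"
proof
  assume *: "\<forall>x<n * p. P (x div p) (x mod p)"
  show "\<forall>d<n. \<forall>i<p. P d i"
  proof (intro allI impI)
    fix d i assume di: "d < n" "i < p"
    then have "d * p + i < Suc d * p" by simp
    also have "\<dots> \<le> n * p" using di by (intro mult_le_mono1) simp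
    finally have "d * p + i < n * p" .
    with * have "P ((d * p + i) div p) ((d * p + i) mod p)" by blast
    then show "P d i" using di by simp
  qed
next
  assume *: "\<forall>d<n. \<forall>i<p. P d i"
  show "\<forall>x<n * p. P (x div p) (x mod p)"
  proof (intro allI impI)
    fix x assume x: "x < n * p"
    then have "p > 0" by (cases p) auto
    with x * show "P (x div p) (x mod p)" by (simp add: less_mult_imp_div_less)
  qed
qed

lemma hankel_carrier: "hankel_H0 p m n B \<in> carrier_mat (n * p) (n * m)"
  by (simp add: hankel_H0_def)

lemma F_o_carrier: "F_o p m n B z \<in> carrier_mat p m"
  by (simp add: F_o_def)

lemma index_F_o:
  assumes "r < p" "i < m"
  shows "F_o p m n B z $$ (r, i) = (\<Sum>k<n. z powi (- int (Suc k)) * B (Suc k) $$ (r, i))"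
proof -
  have "F_o p m n B z $$ (r, i) = (\<Sum>k = 1..n. z powi (- int k) * B k $$ (r, i))"
    using assms by (simp add: F_o_def)
  also have "\<dots> = (\<Sum>k<n. z powi (- int (Suc k)) * B (Suc k) $$ (r, i))"
    by (rule sum.reindex_bij_witness[of _ Suc "\<lambda>k. k - 1"]) auto
  finally show ?thesis .
qed

text \<open>
  In the first block column the entry \<open>B\<^bsub>l+1\<^esub>\<close> of \<open>H\<^sub>0\<close> is never cut off, and the cut-off in block column
  \<open>x div m\<close> is exactly the condition \<open>l + d < n\<close> in the autocorrelation of lag \<open>d = x div m\<close>.
\<close>

lemma index_hankel_gram:
  assumes "x < n * m" "j < m" "n \<ge> 1"
  shows "(mat_adjoint (hankel_H0 p m n B) * hankel_H0 p m n B) $$ (x, j)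
    = autocorr n p (\<lambda>k r i. B (Suc k) $$ (r, i)) (x div m) (x mod m) j"
proof -
  let ?H = "hankel_H0 p m n B"
  have j: "j < n * m" using assms by (cases n) auto
  have "(mat_adjoint ?H * ?H) $$ (x, j) = (\<Sum>y<n * p. cnj (?H $$ (y, x)) * ?H $$ (y, j))"
    using assms j by (intro index_adjoint_mult[OF hankel_carrier])
  also have "\<dots> = (\<Sum>y<n * p. (\<lambda>l r. if l + x div m < n
      then cnj (B (Suc (l + x div m)) $$ (r, x mod m)) * B (Suc l) $$ (r, j) else 0)
        (y div p) (y mod p))"
  proof (rule sum.cong[OF refl])
    fix y assume "y \<in> {..<n * p}"
    then have "y div p < n" "y < n * p" by (auto simp: less_mult_imp_div_less)
    then show "cnj (?H $$ (y, x)) * ?H $$ (y, j) = (\<lambda>l r. if l + x div m < n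
      then cnj (B (Suc (l + x div m)) $$ (r, x mod m)) * B (Suc l) $$ (r, j) else 0)
        (y div p) (y mod p)"
      using assms j by (simp add: hankel_H0_def Let_def Suc_le_eq)
  qed
  also have "\<dots> = autocorr n p (\<lambda>k r i. B (Suc k) $$ (r, i)) (x div m) (x mod m) j"
    unfolding autocorr_eq_double_sum by (rule sum_div_mod)
  finally show ?thesis .
qed

lemma index_hankel_cogram:
  assumes "i < p" "x < n * p" "n \<ge> 1"
  shows "(hankel_H0 p m n B * mat_adjoint (hankel_H0 p m n B)) $$ (i, x)
    = autocorr n m (\<lambda>k r i. B (Suc k) $$ (i, r)) (x div p) (x mod p) i"
proof -
  let ?H = "hankel_H0 p m n B"
  have i: "i < n * p" using assms by (cases n) auto
  have "(?H * mat_adjoint ?H) $$ (i, x) = (\<Sum>y<n * m. cnj (?H $$ (x, y)) * ?H $$ (i, y))"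
    using assms i by (intro index_mult_adjoint[OF hankel_carrier])
  also have "\<dots> = (\<Sum>y<n * m. (\<lambda>l r. if l + x div p < n
      then cnj (B (Suc (l + x div p)) $$ (x mod p, r)) * B (Suc l) $$ (i, r) else 0)
        (y div m) (y mod m))"
  proof (rule sum.cong[OF refl])
    fix y assume "y \<in> {..<n * m}"
    then have "y div m < n" "y < n * m" by (auto simp: less_mult_imp_div_less)
    then show "cnj (?H $$ (x, y)) * ?H $$ (i, y) = (\<lambda>l r. if l + x div p < n
      then cnj (B (Suc (l + x div p)) $$ (x mod p, r)) * B (Suc l) $$ (i, r) else 0)
        (y div m) (y mod m)"
      using assms i by (simp add: hankel_H0_def Let_def Suc_le_eq add.commute)
  qed
  also have "\<dots> = autocorr n m (\<lambda>k r i. B (Suc k) $$ (i, r)) (x div p) (x mod p) i"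
    unfolding autocorr_eq_double_sum by (rule sum_div_mod)
  finally show ?thesis .
qed

text \<open>Multiplication by the stacked identity selects the first block column.\<close>

lemma index_mult_first_block_column:
  fixes A :: "complex mat"
  assumes A: "A \<in> carrier_mat s (n * m)" and n: "n \<ge> 1" and x: "x < s" and j: "j < m"
  shows "(A * (1\<^sub>m m @\<^sub>r 0\<^sub>m (m * (n - 1)) m)) $$ (x, j) = A $$ (x, j)"
proof -
  let ?E = "1\<^sub>m m @\<^sub>r 0\<^sub>m (m * (n - 1)) m :: complex mat"
  have nm: "m + m * (n - 1) = n * m" using n by (cases n) auto
  have E: "?E \<in> carrier_mat (n * m) m"
    using carrier_append_rows[of "1\<^sub>m m :: complex mat" m m "0\<^sub>m (m * (n - 1)) m" "m * (n - 1)"]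
    unfolding nm by simp
  have jn: "j < n * m" using j n by (cases n) auto
  have "(A * ?E) $$ (x, j) = (\<Sum>y<n * m. A $$ (x, y) * ?E $$ (y, j))"
    using A E x j by (auto simp: scalar_prod_def atLeast0LessThan intro!: sum.cong)
  also have "\<dots> = (\<Sum>y<n * m. if y = j then A $$ (x, y) else 0)"
    using j nm by (intro sum.cong refl) (auto simp: append_rows_def)
  also have "\<dots> = A $$ (x, j)" using jn by simp
  finally show ?thesis .
qed

lemma index_mult_first_block_row:
  fixes A :: "complex mat"
  assumes A: "A \<in> carrier_mat (n * p) s" and n: "n \<ge> 1" and i: "i < p" and x: "x < s"
  shows "(append_cols (1\<^sub>m p) (0\<^sub>m p ((n - 1) * p)) * A) $$ (i, x) = A $$ (i, x)"
proof -
  let ?E = "append_cols (1\<^sub>m p) (0\<^sub>m p ((n - 1) * p)) :: complex mat"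
  have np: "p + (n - 1) * p = n * p" using n by (cases n) auto
  have E: "?E \<in> carrier_mat p (n * p)"
    using np by (auto simp: append_cols_def)
  have inp: "i < n * p" using i n by (cases n) auto
  have "(?E * A) $$ (i, x) = (\<Sum>y<n * p. ?E $$ (i, y) * A $$ (y, x))"
    using A E i x by (auto simp: scalar_prod_def atLeast0LessThan intro!: sum.cong)
  also have "\<dots> = (\<Sum>y<n * p. if y = i then A $$ (y, x) else 0)"
    using i np by (intro sum.cong refl) (auto simp: append_cols_def)
  also have "\<dots> = A $$ (i, x)" using inp by simp
  finally show ?thesis .
qed

section \<open>The isometric and co-isometric cases\<close>

text \<open>An index below \<open>n * m\<close> equals \<open>j < m\<close> exactly when it sits at offset \<open>j\<close> in block 0.\<close>

lemma eq_iff_div_mod: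
  assumes "j < (m::nat)"
  shows "x = j \<longleftrightarrow> x div m = 0 \<and> x mod m = j"
  using assms by (auto simp: Euclidean_Rings.div_eq_0_iff)

lemma hankel_first_block_column_iff:
  assumes n: "n \<ge> 1"
  shows "(1\<^sub>m (n * m) - mat_adjoint (hankel_H0 p m n B) * hankel_H0 p m n B)
         * (1\<^sub>m m @\<^sub>r 0\<^sub>m (m * (n - 1)) m) = 0\<^sub>m (n * m) m
     \<longleftrightarrow> (\<forall>d<n. \<forall>i<m. \<forall>j<m.
           autocorr n p (\<lambda>k r i. B (Suc k) $$ (r, i)) d i j = of_bool (d = 0 \<and> i = j))"
    (is "?D * ?E = _ \<longleftrightarrow> ?corr")
proof -
  let ?H = "hankel_H0 p m n B"
  let ?c = "autocorr n p (\<lambda>k r i. B (Suc k) $$ (r, i))"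
  have HH: "mat_adjoint ?H * ?H \<in> carrier_mat (n * m) (n * m)"
    using hankel_carrier mat_adjoint_carrier[OF hankel_carrier] by (rule mult_carrier_mat[rotated])
  have D: "?D \<in> carrier_mat (n * m) (n * m)" using HH by (rule minus_carrier_mat)
  have entry: "(?D * ?E) $$ (x, j)
      = 0 \<longleftrightarrow> ?c (x div m) (x mod m) j = of_bool (x div m = 0 \<and> x mod m = j)"
    if x: "x < n * m" and j: "j < m" for x j
  proof -
    have jn: "j < n * m" using j n by (cases n) auto
    have "(?D * ?E) $$ (x, j) = ?D $$ (x, j)"
      using index_mult_first_block_column[OF D n x j] .
    also have "\<dots> = of_bool (x = j) - (mat_adjoint ?H * ?H) $$ (x, j)"
      using HH x jn by (subst index_minus_mat) auto
    finally show ?thesis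
      using index_hankel_gram[OF x j n, of p B] eq_iff_div_mod[OF j, of x] by auto
  qed
  have E: "dim_col ?E = m" by (simp add: append_rows_def)
  have "?D * ?E = 0\<^sub>m (n * m) m \<longleftrightarrow> (\<forall>x<n * m. \<forall>j<m. (?D * ?E) $$ (x, j) = 0)"
    using D E by (auto simp: mat_eq_iff)
  also have "\<dots> \<longleftrightarrow> (\<forall>x<n * m. (\<lambda>d i. \<forall>j<m. ?c d i j = of_bool (d = 0 \<and> i = j))
      (x div m) (x mod m))"
    using entry by simp
  also have "\<dots> \<longleftrightarrow> ?corr" by (rule all_div_mod)
  finally show ?thesis .
qed

lemma hankel_first_block_row_iff:
  assumes n: "n \<ge> 1"
  shows "append_cols (1\<^sub>m p) (0\<^sub>m p ((n - 1) * p))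
         * (1\<^sub>m (n * p) - hankel_H0 p m n B * mat_adjoint (hankel_H0 p m n B)) = 0\<^sub>m p (n * p)
     \<longleftrightarrow> (\<forall>d<n. \<forall>i<p. \<forall>j<p.
           autocorr n m (\<lambda>k r i. B (Suc k) $$ (i, r)) d i j = of_bool (d = 0 \<and> i = j))"
    (is "?E * ?D = _ \<longleftrightarrow> ?corr")
proof -
  let ?H = "hankel_H0 p m n B"
  let ?c = "autocorr n m (\<lambda>k r i. B (Suc k) $$ (i, r))"
  have HH: "?H * mat_adjoint ?H \<in> carrier_mat (n * p) (n * p)"
    using hankel_carrier mat_adjoint_carrier[OF hankel_carrier] by (rule mult_carrier_mat)
  have D: "?D \<in> carrier_mat (n * p) (n * p)" using HH by (rule minus_carrier_mat)
  have entry: "(?E * ?D) $$ (j, x)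
      = 0 \<longleftrightarrow> ?c (x div p) (x mod p) j = of_bool (x div p = 0 \<and> x mod p = j)"
    if x: "x < n * p" and j: "j < p" for x j
  proof -
    have jn: "j < n * p" using j n by (cases n) auto
    have "(?E * ?D) $$ (j, x) = ?D $$ (j, x)"
      using index_mult_first_block_row[OF D n j x] .
    also have "\<dots> = of_bool (x = j) - (?H * mat_adjoint ?H) $$ (j, x)"
      using HH x jn by (subst index_minus_mat) auto
    finally show ?thesis
      using index_hankel_cogram[OF j x n, of m B] eq_iff_div_mod[OF j, of x] by auto
  qed
  have E: "dim_row ?E = p" by (simp add: append_cols_def)
  have "?E * ?D = 0\<^sub>m p (n * p) \<longleftrightarrow> (\<forall>x<n * p. \<forall>j<p. (?E * ?D) $$ (j, x) = 0)"
    using D E by (auto simp: mat_eq_iff)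
  also have "\<dots> \<longleftrightarrow> (\<forall>x<n * p. (\<lambda>d i. \<forall>j<p. ?c d i j = of_bool (d = 0 \<and> i = j))
      (x div p) (x mod p))"
    using entry by simp
  also have "\<dots> \<longleftrightarrow> ?corr" by (rule all_div_mod)
  finally show ?thesis .
qed

lemma F_o_isometry_iff:
  assumes n: "n \<ge> 1"
  shows "(\<forall>z. cmod z = 1 \<longrightarrow> mat_adjoint (F_o p m n B z) * F_o p m n B z = 1\<^sub>m m)
     \<longleftrightarrow> (1\<^sub>m (n * m) - mat_adjoint (hankel_H0 p m n B) * hankel_H0 p m n B)
         * (1\<^sub>m m @\<^sub>r 0\<^sub>m (m * (n - 1)) m) = 0\<^sub>m (n * m) m"
proof -
  let ?X = "\<lambda>k r i. B (Suc k) $$ (r, i)"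
  have "mat_adjoint (F_o p m n B z) * F_o p m n B z = 1\<^sub>m m \<longleftrightarrow> (\<forall>i<m. \<forall>j<m.
      (\<Sum>r<p. cnj (laurent_val n ?X z r i) * laurent_val n ?X z r j) = of_bool (i = j))" for z
  proof -
    have "mat_adjoint (F_o p m n B z) * F_o p m n B z \<in> carrier_mat m m"
      using mat_adjoint_carrier[OF F_o_carrier] F_o_carrier by (rule mult_carrier_mat)
    then have "mat_adjoint (F_o p m n B z) * F_o p m n B z = 1\<^sub>m m \<longleftrightarrow> (\<forall>i<m. \<forall>j<m.
        (mat_adjoint (F_o p m n B z) * F_o p m n B z) $$ (i, j) = of_bool (i = j))"
      by (auto simp: mat_eq_iff)
    then show ?thesis
      by (simp add: index_adjoint_mult[OF F_o_carrier] index_F_o laurent_val_def)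
  qed
  then show ?thesis
    by (simp only: isometric_on_circle_iff[OF n] hankel_first_block_column_iff[OF n])
qed

lemma F_o_coisometry_iff:
  assumes n: "n \<ge> 1"
  shows "(\<forall>z. cmod z = 1 \<longrightarrow> F_o p m n B z * mat_adjoint (F_o p m n B z) = 1\<^sub>m p)
     \<longleftrightarrow> append_cols (1\<^sub>m p) (0\<^sub>m p ((n - 1) * p))
         * (1\<^sub>m (n * p) - hankel_H0 p m n B * mat_adjoint (hankel_H0 p m n B)) = 0\<^sub>m p (n * p)"
proof -
  let ?X = "\<lambda>k r i. B (Suc k) $$ (i, r)"
  have "F_o p m n B z * mat_adjoint (F_o p m n B z) = 1\<^sub>m p \<longleftrightarrow> (\<forall>i<p. \<forall>j<p.
      (\<Sum>r<m. cnj (laurent_val n ?X z r i) * laurent_val n ?X z r j) = of_bool (i = j))" for z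
  proof -
    have "F_o p m n B z * mat_adjoint (F_o p m n B z) \<in> carrier_mat p p"
      using F_o_carrier mat_adjoint_carrier[OF F_o_carrier] by (rule mult_carrier_mat)
    \<comment> \<open>The entry \<open>(j, i)\<close> is the sum in which the row of index \<open>i\<close> is conjugated.\<close>
    then have "F_o p m n B z * mat_adjoint (F_o p m n B z) = 1\<^sub>m p \<longleftrightarrow> (\<forall>i<p. \<forall>j<p.
        (F_o p m n B z * mat_adjoint (F_o p m n B z)) $$ (j, i) = of_bool (i = j))"
      by (auto simp: mat_eq_iff)
    then show ?thesis
      by (simp add: index_mult_adjoint[OF F_o_carrier] index_F_o laurent_val_def)
  qed
  then show ?thesis
    by (simp only: isometric_on_circle_iff[OF n] hankel_first_block_row_iff[OF n])
qed

lemma rational_mat_fun_F_o: "rational_mat_fun p m (F_o p m n B)"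
  unfolding rational_mat_fun_def
  using rational_fun_negative_powers[where n = n] by (simp add: F_o_carrier) (simp add: F_o_def)

lemma adjoint_inverse_square_iff:
  fixes A :: "complex mat"
  assumes "A \<in> carrier_mat p p"
  shows "mat_adjoint A * A = 1\<^sub>m p \<longleftrightarrow> A * mat_adjoint A = 1\<^sub>m p"
  using assms mat_adjoint_carrier[OF assms] mat_mult_left_right_inverse by blast

theorem theorem4p1:
  fixes p m n :: nat and B :: "nat \<Rightarrow> complex mat"
  assumes "n \<ge> 1"
    and "\<And>k. k \<in> {1..n} \<Longrightarrow> B k \<in> carrier_mat p m"
  shows "(p \<ge> m \<longrightarrow>
      (F_o p m n B \<in> class_U p m \<longleftrightarrow>
       (1\<^sub>m (n * m) - mat_adjoint (hankel_H0 p m n B) * hankel_H0 p m n B)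
         * (1\<^sub>m m @\<^sub>r 0\<^sub>m (m * (n - 1)) m) = 0\<^sub>m (n * m) m)) \<and>
    (m \<ge> p \<longrightarrow>
      (F_o p m n B \<in> class_U p m \<longleftrightarrow>
       append_cols (1\<^sub>m p) (0\<^sub>m p ((n - 1) * p))
         * (1\<^sub>m (n * p) - hankel_H0 p m n B * mat_adjoint (hankel_H0 p m n B)) = 0\<^sub>m p (n * p)))"
proof -
  let ?F = "F_o p m n B"
  have square: "mat_adjoint (?F z) * ?F z = 1\<^sub>m m \<longleftrightarrow> ?F z * mat_adjoint (?F z) = 1\<^sub>m p"
    if "p = m" for z
    using that adjoint_inverse_square_iff[of "?F z" p] F_o_carrier[of p m n B z] by simp
  have tall: "?F \<in> class_U p m \<longleftrightarrow> (\<forall>z. cmod z = 1 \<longrightarrow> mat_adjoint (?F z) * ?F z = 1\<^sub>m m)"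
    if "p \<ge> m"
    using that square by (cases "p = m") (auto simp: class_U_def rational_mat_fun_F_o)
  have wide: "?F \<in> class_U p m \<longleftrightarrow> (\<forall>z. cmod z = 1 \<longrightarrow> ?F z * mat_adjoint (?F z) = 1\<^sub>m p)"
    if "m \<ge> p"
    using that square by (cases "p = m") (auto simp: class_U_def rational_mat_fun_F_o)
  show ?thesis
    using tall wide F_o_isometry_iff[OF assms(1)] F_o_coisometry_iff[OF assms(1)] by blast
qed

end
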